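(* For every even positive integer $k$ there exists a stacked triangulation $G_k$ with $n = (7k+4)/2$ vertices such that every edge guard set of $G_k$ has at least $k = (2n-4)/7$ edges.
   Context: A plane graph is a simple graph together with a crossing-free embedding in $\mathbb{R}^2$. Stacked triangulations are defined recursively: (i) a triangle (a plane $3$-cycle) is a stacked triangulation; (ii) if $G$ is a stacked triangulation and $f=(x,y,z)$ is an inner face, then the plane graph obtained by placing a new vertex $v$ inside $f$ and joining it to $x,y,z$ is a stacked triangulation. For a plane graph $G=(V,E)$, a face $f$ is guarded by an edge $vw \in E$ if at least one of $v,w$ lies on the boundary of $f$. A set $\Gamma \subseteq E$ is an edge guard set if every face of $G$ (including the outer face) is guarded by some edge of $\Gamma$. *)

theory Defs
  imports "HOL-Analysis.Analysis"
begin

text \<open>Vertices are points of the plane, edges are two-element sets of vertices, and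
  \<open>curve G e\<close> is the point set by which the edge \<open>e\<close> is drawn (its values on
  non-edges are irrelevant).\<close>

record drawn_graph =
  verts :: "(real^2) set"
  edges :: "(real^2) set set"
  curve :: "(real^2) set \<Rightarrow> (real^2) set"

definition arc_between :: "real^2 \<Rightarrow> real^2 \<Rightarrow> (real^2) set \<Rightarrow> bool" where
  "arc_between u v C \<longleftrightarrow>
     (\<exists>g. arc g \<and> pathstart g = u \<and> pathfinish g = v \<and> path_image g = C)"

text \<open>The last two conjuncts of \<open>plane_graph\<close> say that a curve meets the vertex set only in its
  endpoints, and that two distinct curves meet only in common endpoints.\<close>

definition plane_graph :: "drawn_graph \<Rightarrow> bool" where
  "plane_graph G \<longleftrightarrow>
     finite (verts G) \<and>
     (\<forall>e\<in>edges G. \<exists>u\<in>verts G. \<exists>v\<in>verts G. u \<noteq> v \<and> e = {u, v} \<and> arc_between u v (curve G e)) \<and>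
     (\<forall>e\<in>edges G. curve G e \<inter> verts G = e) \<and>
     (\<forall>e\<in>edges G. \<forall>e'\<in>edges G. e \<noteq> e' \<longrightarrow> curve G e \<inter> curve G e' = e \<inter> e')"

definition point_set :: "drawn_graph \<Rightarrow> (real^2) set" where
  "point_set G = verts G \<union> (\<Union>e\<in>edges G. curve G e)"

definition faces :: "drawn_graph \<Rightarrow> (real^2) set set" where
  "faces G = components (- point_set G)"

definition inner_faces :: "drawn_graph \<Rightarrow> (real^2) set set" where
  "inner_faces G = {f \<in> faces G. bounded f}"

text \<open>In rule \<open>stack\<close>, the drawing of the old edges is kept, and the three new edges are drawn
  inside \<open>f\<close> apart from their ends \<open>x\<close>, \<open>y\<close>, \<open>z\<close>; that they do not cross is part of
  \<open>plane_graph G'\<close>.\<close>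

inductive stacked_triangulation :: "drawn_graph \<Rightarrow> bool" where
  triangle:
    "\<lbrakk> plane_graph G; x \<noteq> y; y \<noteq> z; x \<noteq> z;
       verts G = {x, y, z}; edges G = {{x, y}, {y, z}, {x, z}} \<rbrakk>
     \<Longrightarrow> stacked_triangulation G"
| stack:
    "\<lbrakk> stacked_triangulation G; f \<in> inner_faces G;
       x \<noteq> y; y \<noteq> z; x \<noteq> z; verts G \<inter> frontier f = {x, y, z};
       v \<in> f; plane_graph G';
       verts G' = insert v (verts G);
       edges G' = edges G \<union> {{v, x}, {v, y}, {v, z}};
       \<forall>e\<in>edges G. curve G' e = curve G e;
       \<forall>w\<in>{x, y, z}. curve G' {v, w} - {w} \<subseteq> f \<rbrakk>
     \<Longrightarrow> stacked_triangulation G'"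

definition guards :: "(real^2) set \<Rightarrow> (real^2) set \<Rightarrow> bool" where
  "guards e f \<longleftrightarrow> (\<exists>v\<in>e. v \<in> frontier f)"

definition edge_guard_set :: "drawn_graph \<Rightarrow> (real^2) set set \<Rightarrow> bool" where
  "edge_guard_set G \<Gamma> \<longleftrightarrow> \<Gamma> \<subseteq> edges G \<and> (\<forall>f\<in>faces G. \<exists>e\<in>\<Gamma>. guards e f)"

lemma stacked_triangulation_plane: "stacked_triangulation G \<Longrightarrow> plane_graph G"
  by (auto elim: stacked_triangulation.cases)

end

theory Submission imports Defs begin

text \<open>Take a stacked triangulation \<open>H\<close> with \<open>(k + 4) / 2\<close> vertices, hence \<open>k\<close> faces, and stack three
  vertices into each face of \<open>H\<close> so that they form a face themselves. An edge guarding that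
  face has an end strictly inside the face of \<open>H\<close>, so no edge serves two faces of \<open>H\<close>.
  Everything is drawn with straight segments; an open triangle that misses the drawing and whose
  sides are edges is a face, so no complete list of the faces is needed. The construction keeps one
  empty triangle open: a vertex stacked into it splits it into three, two of which receive their
  three vertices while the third one stays open.\<close>

section \<open>Straight-line drawings and triangles in the plane\<close>

text \<open>The hull of a two-point set is the segment, so unordered edges need no orientation. The
  curve of an edge does not depend on \<open>V\<close> or \<open>E\<close>, hence old edges keep
  their curves when a vertex is stacked.\<close>

definition straight_drawing :: "(real^2) set \<Rightarrow> (real^2) set set \<Rightarrow> drawn_graph" where
  "straight_drawing V E = \<lparr>verts = V, edges = E, curve = (\<lambda>e. convex hull e)\<rparr>"

lemma straight_drawing_simps [simp]:
  "verts (straight_drawing V E) = V"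
  "edges (straight_drawing V E) = E"
  "curve (straight_drawing V E) e = convex hull e"
  "point_set (straight_drawing V E) = V \<union> (\<Union>e\<in>E. convex hull e)"
  by (simp_all add: straight_drawing_def point_set_def)

lemma triangle_frontier:
  fixes T :: "(real^2) set"
  assumes "card T = 3"
  shows "frontier (convex hull T) = (\<Union>x\<in>T. convex hull (T - {x}))"
  using frontier_of_convex_hull[of T] assms by auto

lemma triangle_interior_nonempty:
  fixes T :: "(real^2) set"
  assumes "card T = 3" "\<not> affine_dependent T"
  shows "interior (convex hull T) \<noteq> {}"
  using interior_convex_hull_eq_empty[of T] assms by auto

lemma frontier_triangle_interior:
  fixes T :: "(real^2) set"
  assumes "card T = 3" "\<not> affine_dependent T"
  shows "frontier (interior (convex hull T)) = frontier (convex hull T)"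
  using convex_closure_interior[of "convex hull T"] triangle_interior_nonempty[OF assms]
  by (simp add: frontier_def)

lemma interior_triangle_not_side:
  fixes T :: "(real^2) set"
  assumes "card T = 3" "v \<in> interior (convex hull T)" "x \<in> T"
  shows "v \<notin> convex hull (T - {x})"
  using assms triangle_frontier[OF assms(1)] by (auto simp: frontier_def)

lemma card_3_another:
  assumes "card T = 3"
  shows "\<exists>y\<in>T. y \<noteq> x"
  using assms by (auto simp: card_3_iff)

text \<open>Ensures that the triangles cut off by a stacked vertex are nondegenerate. A side is a
  face of the convex set \<open>convex hull T\<close>, so its affine hull meets the triangle only in
  the side itself; an interior point misses the side and therefore the whole line.\<close>

lemma exchanged_triangle:
  fixes T :: "(real^2) set"
  assumes T: "card T = 3" "\<not> affine_dependent T"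
    and v: "v \<in> interior (convex hull T)" and x: "x \<in> T"
  shows "v \<notin> T" "card (insert v (T - {x})) = 3" "\<not> affine_dependent (insert v (T - {x}))"
proof -
  have fin: "finite T" using T(1) card.infinite by fastforce
  show vT: "v \<notin> T"
  proof
    assume "v \<in> T"
    then obtain y where y: "y \<in> T" "y \<noteq> v"
      using card_3_another[OF T(1)] by blast
    then have "v \<in> convex hull (T - {y})" using \<open>v \<in> T\<close> by (simp add: hull_inc)
    then show False using interior_triangle_not_side[OF T(1) v y(1)] by simp
  qed
  then show "card (insert v (T - {x})) = 3"
    using T(1) x fin by simp
  have "convex hull (T - {x}) face_of convex hull T"
    using T(2) face_of_convex_hull_affine_independent by blast
  then have "convex hull (T - {x}) = affine hull (convex hull (T - {x})) \<inter> convex hull T"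
    using face_of_imp_eq_affine_Int by (metis convex_convex_hull)
  then have "v \<notin> affine hull (T - {x})"
    using interior_triangle_not_side[OF T(1) v x] v interior_subset
    by (auto simp: subset_iff)
  then show "\<not> affine_dependent (insert v (T - {x}))"
    using affine_independent_insert affine_independent_Diff[OF T(2)] by blast
qed

lemma finite_plane_graph_edges:
  assumes "plane_graph G"
  shows "finite (edges G)" "\<And>e. e \<in> edges G \<Longrightarrow> e \<subseteq> verts G"
proof -
  show sub: "e \<subseteq> verts G" if "e \<in> edges G" for e
    using assms that unfolding plane_graph_def by fastforce
  then have "edges G \<subseteq> Pow (verts G)" by auto
  moreover have "finite (Pow (verts G))" using assms by (simp add: plane_graph_def)
  ultimately show "finite (edges G)" by (rule finite_subset)
qed

section \<open>Empty triangles as faces\<close>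

text \<open>The invariant that replaces a list of the inner faces. Affine independence keeps the
  open triangle nonempty, so that there is a place for the next vertex.\<close>

definition empty_triangle :: "(real^2) set \<Rightarrow> (real^2) set set \<Rightarrow> (real^2) set \<Rightarrow> bool" where
  "empty_triangle V E T \<longleftrightarrow> card T = 3 \<and> \<not> affine_dependent T \<and> T \<subseteq> V \<and>
     (\<forall>x\<in>T. \<forall>y\<in>T. x \<noteq> y \<longrightarrow> {x, y} \<in> E) \<and>
     interior (convex hull T) \<inter> point_set (straight_drawing V E) = {}"

text \<open>A connected set that contains \<open>C\<close> properly must meet
  \<open>frontier C\<close>, hence \<open>P\<close>; so \<open>C\<close> is maximal among the
  connected sets that avoid \<open>P\<close>.\<close>

lemma component_of_open_frontier:
  fixes P :: "'a::topological_space set"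
  assumes "connected C" "C \<noteq> {}" "C \<inter> P = {}" "frontier C \<subseteq> P"
  shows "C \<in> components (- P)"
proof -
  have "D = C" if "C \<subseteq> D" "D \<subseteq> - P" "connected D" for D
  proof (rule ccontr)
    assume "D \<noteq> C"
    then have "D \<inter> frontier C \<noteq> {}"
      using connected_Int_frontier[of D C] that assms(2) by blast
    then show False using that assms(4) by blast
  qed
  then show ?thesis using assms by (auto simp: in_components_maximal)
qed

lemma triangle_frontier_sides:
  fixes a :: "real^2"
  assumes "a \<noteq> b" "b \<noteq> c" "a \<noteq> c"
  shows "frontier (convex hull {a, b, c}) = convex hull {b, c} \<union> convex hull {a, c} \<union> convex hull {a, b}"
proof -
  have "{a, b, c} - {a} = {b, c}" "{a, b, c} - {b} = {a, c}" "{a, b, c} - {c} = {a, b}"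
    using assms by auto
  moreover have "card {a, b, c} = 3" using assms by simp
  ultimately show ?thesis using triangle_frontier[of "{a, b, c}"] by auto
qed

text \<open>Sides are indexed by pairs of distinct corners, to match the edge condition in
  \<open>empty_triangle\<close> without naming the corners.\<close>

lemma triangle_frontier_edges:
  fixes T :: "(real^2) set"
  assumes "card T = 3"
  shows "frontier (convex hull T) = \<Union>{convex hull {x, y} |x y. x \<in> T \<and> y \<in> T \<and> x \<noteq> y}"
proof -
  obtain a b c where T: "T = {a, b, c}" and ne: "a \<noteq> b" "b \<noteq> c" "a \<noteq> c"
    using assms by (auto simp: card_3_iff)
  have fr: "frontier (convex hull T) = convex hull {b, c} \<union> convex hull {a, c} \<union> convex hull {a, b}"
    unfolding T using ne by (rule triangle_frontier_sides)
  have "{x, y} = {b, c} \<or> {x, y} = {a, c} \<or> {x, y} = {a, b}" if "x \<in> T" "y \<in> T" "x \<noteq> y" for x y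
    using that T by auto
  then have "\<Union>{convex hull {x, y} |x y. x \<in> T \<and> y \<in> T \<and> x \<noteq> y} \<subseteq> frontier (convex hull T)"
    unfolding fr by (smt (verit) UnI1 UnI2 Union_iff mem_Collect_eq subsetI)
  moreover have "frontier (convex hull T) \<subseteq> \<Union>{convex hull {x, y} |x y. x \<in> T \<and> y \<in> T \<and> x \<noteq> y}"
    unfolding fr using T ne by blast
  ultimately show ?thesis by (rule equalityI[rotated])
qed

text \<open>The sides are drawn edges, so the frontier lies in the drawing and the component
  criterion applies. A drawn edge contains no vertices but its ends, so only the corners are on the
  frontier. Both facts are premises of rule \<open>stack\<close>.\<close>

lemma empty_triangle_face:
  assumes G: "plane_graph (straight_drawing V E)" and T: "empty_triangle V E T"
  shows "interior (convex hull T) \<in> inner_faces (straight_drawing V E)"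
    and "V \<inter> frontier (interior (convex hull T)) = T"
proof -
  have fin: "finite T" and c3: "card T = 3" and aff: "\<not> affine_dependent T" and TV: "T \<subseteq> V"
    and edge: "\<And>x y. \<lbrakk>x \<in> T; y \<in> T; x \<noteq> y\<rbrakk> \<Longrightarrow> {x, y} \<in> E"
    using T aff_independent_finite unfolding empty_triangle_def by auto
  have fr: "frontier (interior (convex hull T)) = \<Union>{convex hull {x, y} |x y. x \<in> T \<and> y \<in> T \<and> x \<noteq> y}"
    using frontier_triangle_interior[OF c3 aff] triangle_frontier_edges[OF c3] by simp
  have "frontier (interior (convex hull T)) \<subseteq> point_set (straight_drawing V E)"
    unfolding fr using edge by auto
  moreover have "bounded (interior (convex hull T))"
    using fin by (meson bounded_convex_hull bounded_interior finite_imp_bounded)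
  ultimately show "interior (convex hull T) \<in> inner_faces (straight_drawing V E)"
    unfolding inner_faces_def faces_def
    using T component_of_open_frontier[of "interior (convex hull T)"]
      triangle_interior_nonempty[OF c3 aff] convex_connected convex_interior convex_convex_hull
    unfolding empty_triangle_def by (metis (mono_tags, lifting) mem_Collect_eq)
  have V: "convex hull {x, y} \<inter> V = {x, y}" if "x \<in> T" "y \<in> T" "x \<noteq> y" for x y
    using G edge[OF that] unfolding plane_graph_def by auto
  show "V \<inter> frontier (interior (convex hull T)) = T"
  proof (intro equalityI subsetI)
    fix w assume "w \<in> V \<inter> frontier (interior (convex hull T))"
    then obtain x y where xy: "x \<in> T" "y \<in> T" "x \<noteq> y" and "w \<in> convex hull {x, y} \<inter> V"
      unfolding fr by blast
    then show "w \<in> T" unfolding V[OF xy] by blast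
  next
    fix w assume w: "w \<in> T"
    obtain y where y: "y \<in> T" "w \<noteq> y" using card_3_another[OF c3, of w] by blast
    then have "w \<in> convex hull {w, y} \<inter> V" unfolding V[OF w y] by simp
    then show "w \<in> V \<inter> frontier (interior (convex hull T))" unfolding fr using w y by blast
  qed
qed

section \<open>Stacking a vertex into an empty triangle\<close>

lemma arc_between_segment:
  assumes "u \<noteq> v"
  shows "arc_between u v (convex hull {u, v})"
  unfolding arc_between_def
  by (rule exI[of _ "linepath u v"]) (use assms in \<open>simp add: segment_convex_hull\<close>)

text \<open>A segment from the interior point \<open>v\<close> to a corner stays in the open
  triangle until it reaches the corner. The open triangle misses the old drawing, so new edges can
  touch old ones only at corners.\<close>

lemma plane_graph_stack:
  assumes G: "plane_graph (straight_drawing V E)" and T: "empty_triangle V E T"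
    and v: "v \<in> interior (convex hull T)"
  shows "plane_graph (straight_drawing (insert v V) (E \<union> (\<lambda>w. {v, w}) ` T))" (is "plane_graph ?G'")
    and "\<And>w. w \<in> T \<Longrightarrow> convex hull {v, w} - {w} \<subseteq> interior (convex hull T)"
    and "v \<notin> V"
proof -
  have c3: "card T = 3" and aff: "\<not> affine_dependent T" and TV: "T \<subseteq> V"
    and dis: "interior (convex hull T) \<inter> (V \<union> (\<Union>e\<in>E. convex hull e)) = {}"
    using T unfolding empty_triangle_def by auto
  have P: "finite V" "\<And>e. e \<in> E \<Longrightarrow> convex hull e \<inter> V = e"
    "\<And>e. e \<in> E \<Longrightarrow> \<exists>u\<in>V. \<exists>v\<in>V. u \<noteq> v \<and> e = {u, v} \<and> arc_between u v (convex hull e)"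
    "\<And>e e'. \<lbrakk>e \<in> E; e' \<in> E; e \<noteq> e'\<rbrakk> \<Longrightarrow> convex hull e \<inter> convex hull e' = e \<inter> e'"
    using G unfolding plane_graph_def by auto
  show vV: "v \<notin> V" using v dis by auto
  show seg: "convex hull {v, w} - {w} \<subseteq> interior (convex hull T)" if "w \<in> T" for w
  proof -
    have "w \<in> closure (convex hull T)" using that closure_subset hull_inc by fast
    then have "open_segment v w \<subseteq> interior (convex hull T)"
      using in_interior_closure_convex_segment[OF convex_convex_hull v] by blast
    then show ?thesis
      using v by (auto simp: segment_convex_hull[symmetric] open_segment_def)
  qed
  have vint: "v \<notin> convex hull e" if "e \<in> E" for e using that v dis by auto
  have old_edge: "convex hull {v, w} \<inter> convex hull e = {v, w} \<inter> e" if "w \<in> T" "e \<in> E" for w e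
  proof -
    have "convex hull {v, w} \<inter> convex hull e \<subseteq> {w}"
      using seg[OF that(1)] dis that(2) by blast
    moreover have "w \<in> convex hull e \<longleftrightarrow> w \<in> e" using P(2)[OF that(2)] TV that(1) by blast
    moreover have "v \<notin> e" using vint[OF that(2)] hull_inc by metis
    moreover have "w \<in> convex hull {v, w}" by (simp add: hull_inc)
    ultimately show ?thesis by blast
  qed
  \<comment> \<open>Since \<open>T\<close> is independent and \<open>{w}\<close>,
    \<open>{w'}\<close> are disjoint, the exchange lemma gives the hull of \<open>{v}\<close> as the
    intersection.\<close>
  have new_edge: "convex hull {v, w} \<inter> convex hull {v, w'} = {v, w} \<inter> {v, w'}"
    if "w \<in> T" "w' \<in> T" "w \<noteq> w'" for w w'
    using convex_hull_exchange_Int[OF aff, of v "{w}" "{w'}"] that v interior_subset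
    by (auto simp: subset_iff)
  have new_verts: "convex hull {v, w} \<inter> insert v V = {v, w}" if "w \<in> T" for w
  proof -
    have "convex hull {v, w} \<inter> V \<subseteq> {w}" using seg[OF that] dis by blast
    moreover have "v \<in> convex hull {v, w}" "w \<in> convex hull {v, w}" by (auto simp: hull_inc)
    ultimately show ?thesis using TV that by blast
  qed
  show "plane_graph ?G'"
    unfolding plane_graph_def straight_drawing_simps
  proof (intro conjI ballI impI)
    show "finite (insert v V)" using P(1) by simp
  next
    fix e assume "e \<in> E \<union> (\<lambda>w. {v, w}) ` T"
    then consider "e \<in> E" | w where "w \<in> T" "e = {v, w}" by blast
    then show "\<exists>u\<in>insert v V. \<exists>va\<in>insert v V. u \<noteq> va \<and> e = {u, va} \<and> arc_between u va (convex hull e)"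
    proof cases
      case 1
      then show ?thesis using P(3) by (meson insertI2)
    next
      case 2
      then have "v \<noteq> w" "w \<in> V" using vV TV by auto
      then show ?thesis using arc_between_segment 2 by blast
    qed
  next
    fix e assume "e \<in> E \<union> (\<lambda>w. {v, w}) ` T"
    then consider "e \<in> E" | w where "w \<in> T" "e = {v, w}" by blast
    then show "convex hull e \<inter> insert v V = e"
      by cases (use P(2) vint new_verts in auto)
  next
    fix e e' assume "e \<in> E \<union> (\<lambda>w. {v, w}) ` T" "e' \<in> E \<union> (\<lambda>w. {v, w}) ` T" "e \<noteq> e'"
    then consider "e \<in> E" "e' \<in> E" | w where "w \<in> T" "e = {v, w}" "e' \<in> E"
      | w where "w \<in> T" "e' = {v, w}" "e \<in> E"
      | w w' where "w \<in> T" "e = {v, w}" "w' \<in> T" "e' = {v, w'}" "w \<noteq> w'" by blast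
    then show "convex hull e \<inter> convex hull e' = e \<inter> e'"
    proof cases
      case 1 then show ?thesis using P(4) \<open>e \<noteq> e'\<close> by simp
    next
      case 2 then show ?thesis using old_edge by simp
    next
      case 3 then show ?thesis using old_edge by blast
    next
      case 4 then show ?thesis using new_edge by simp
    qed
  qed
qed

text \<open>The new triangle lies inside \<open>T\<close>, so the old drawing stays outside its
  interior. Two of the new segments are its own sides; only the segment from \<open>v\<close> to the
  dropped corner \<open>x\<close> needs an argument.\<close>

lemma empty_triangle_stack_new:
  assumes T: "empty_triangle V E T" and v: "v \<in> interior (convex hull T)" and x: "x \<in> T"
  shows "empty_triangle (insert v V) (E \<union> (\<lambda>w. {v, w}) ` T) (insert v (T - {x}))"
proof -
  have c3: "card T = 3" and aff: "\<not> affine_dependent T" and TV: "T \<subseteq> V"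
    and edge: "\<And>x y. \<lbrakk>x \<in> T; y \<in> T; x \<noteq> y\<rbrakk> \<Longrightarrow> {x, y} \<in> E"
    and dis: "interior (convex hull T) \<inter> (V \<union> (\<Union>e\<in>E. convex hull e)) = {}"
    using T unfolding empty_triangle_def by auto
  let ?U = "insert v (T - {x})"
  note U = exchanged_triangle[OF c3 aff v x]
  have vT: "v \<in> convex hull T" using v interior_subset by blast
  have "convex hull ?U \<subseteq> convex hull T"
    using vT by (intro hull_minimal) (auto simp: hull_inc)
  then have sub: "interior (convex hull ?U) \<subseteq> interior (convex hull T)"
    by (rule interior_mono)
  have fr: "convex hull {a, b} \<inter> interior (convex hull ?U) = {}"
    if "a \<in> ?U" "b \<in> ?U" "a \<noteq> b" for a b
    using triangle_frontier_edges[OF U(2)] that unfolding frontier_def by blast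
  have vU: "v \<notin> interior (convex hull ?U)"
  proof -
    obtain y where "y \<in> ?U" "y \<noteq> v" using card_3_another[OF U(2)] by blast
    then show ?thesis using fr[of v y] hull_inc[of v "{v, y}"] by blast
  qed
  have "convex hull {v, w} \<inter> interior (convex hull ?U) = {}" if "w \<in> T" for w
  proof (cases "w = x")
    case True
    \<comment> \<open>Because \<open>x\<close> is not in \<open>T - {x}\<close>, only
      \<open>v\<close> is common to both hulls, and \<open>v\<close> is a corner of the new
      triangle, not an interior point.\<close>
    have "convex hull {v, x} \<inter> convex hull ?U = convex hull (insert v ({x} \<inter> (T - {x})))"
      using convex_hull_exchange_Int[OF aff vT, of "{x}" "T - {x}"] x by auto
    then have "convex hull {v, x} \<inter> convex hull ?U = {v}" by simp
    then have "t = v" if "t \<in> convex hull {v, x}" "t \<in> interior (convex hull ?U)" for t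
    proof -
      have "t \<in> convex hull ?U" using that(2) interior_subset by (rule rev_subsetD)
      with that(1) have "t \<in> convex hull {v, x} \<inter> convex hull ?U" by (rule IntI)
      then show "t = v" unfolding \<open>convex hull {v, x} \<inter> convex hull ?U = {v}\<close> by (rule singletonD)
    qed
    then show ?thesis using vU True by (metis disjoint_iff)
  next
    case False
    then show ?thesis using fr[of v w] that U(1) by (metis DiffI insertCI singletonD)
  qed
  then have "interior (convex hull ?U) \<inter> point_set (straight_drawing (insert v V) (E \<union> (\<lambda>w. {v, w}) ` T)) = {}"
    using sub dis vU unfolding straight_drawing_simps by blast
  moreover have "{a, b} \<in> E \<union> (\<lambda>w. {v, w}) ` T" if "a \<in> ?U" "b \<in> ?U" "a \<noteq> b" for a b
    using that edge[of a b] by (auto simp: insert_commute)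
  ultimately show ?thesis
    unfolding empty_triangle_def using U(2,3) TV by blast
qed

lemma empty_triangle_interior:
  assumes "empty_triangle V E T"
  obtains v where "v \<in> interior (convex hull T)"
  using assms triangle_interior_nonempty unfolding empty_triangle_def by blast

text \<open>Stacking is local: the new segments lie in the face that is filled, apart from their
  ends at old vertices. Any other face is disjoint from this open set, and so is its closure; hence
  it survives and does not get \<open>v\<close> on its frontier. Other empty triangles survive
  because their interiors are such faces.\<close>

lemma stack_step:
  assumes G: "stacked_triangulation (straight_drawing V E)" and T: "empty_triangle V E T"
    and v: "v \<in> interior (convex hull T)"
  shows "v \<notin> V"
    "stacked_triangulation (straight_drawing (insert v V) (E \<union> (\<lambda>w. {v, w}) ` T))"
    "\<And>U. \<lbrakk>empty_triangle V E U; U \<noteq> T\<rbrakk> \<Longrightarrow> empty_triangle (insert v V) (E \<union> (\<lambda>w. {v, w}) ` T) U"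
    "\<And>g. \<lbrakk>g \<in> faces (straight_drawing V E); g \<noteq> interior (convex hull T)\<rbrakk> \<Longrightarrow>
        g \<in> faces (straight_drawing (insert v V) (E \<union> (\<lambda>w. {v, w}) ` T)) \<and> v \<notin> frontier g"
proof -
  let ?f = "interior (convex hull T)"
  have c3: "card T = 3" using T unfolding empty_triangle_def by auto
  let ?E = "E \<union> (\<lambda>w. {v, w}) ` T"
  let ?G = "straight_drawing V E" and ?G' = "straight_drawing (insert v V) ?E"
  have pl: "plane_graph ?G" using G by (rule stacked_triangulation_plane)
  note S = plane_graph_stack[OF pl T v] and F = empty_triangle_face[OF pl T]
  obtain x y z where xyz: "x \<noteq> y" "y \<noteq> z" "x \<noteq> z" "T = {x, y, z}"
    using c3 by (auto simp: card_3_iff)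
  show "stacked_triangulation ?G'"
    by (rule stacked_triangulation.stack[OF G F(1) xyz(1-3) _ v S(1)])
      (use F(2) S(2) xyz(4) in auto)
  have ff: "?f \<in> faces ?G" using F(1) by (simp add: inner_faces_def)
  show keep: "g \<in> faces ?G' \<and> v \<notin> frontier g" if g: "g \<in> faces ?G" "g \<noteq> ?f" for g
  proof -
    have dis: "g \<inter> ?f = {}"
      using g ff components_nonoverlap unfolding faces_def by blast
    have gP: "g \<inter> point_set ?G = {}"
      using in_components_subset g(1) unfolding faces_def by blast
    have sub: "convex hull {v, w} \<subseteq> insert w ?f" if "w \<in> T" for w using S(2)[OF that] by blast
    have "T \<subseteq> V" using T unfolding empty_triangle_def by auto
    then have "g \<inter> convex hull {v, w} = {}" if "w \<in> T" for w
      using sub[OF that] dis gP that by auto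
    then have "g \<subseteq> - point_set ?G'" using gP dis v by auto
    \<comment> \<open>A component of a set remains a component of every smaller set that still
      contains it.\<close>
    moreover have "- point_set ?G' \<subseteq> - point_set ?G" by auto
    ultimately have "g \<in> faces ?G'"
      using g(1) components_intermediate_subset unfolding faces_def by blast
    moreover have "?f \<inter> closure g = {}"
      using open_Int_closure_eq_empty[of ?f g] dis by auto
    ultimately show ?thesis using v by (auto simp: frontier_def)
  qed
  show "empty_triangle (insert v V) ?E U" if U: "empty_triangle V E U" "U \<noteq> T" for U
  proof -
    note FU = empty_triangle_face[OF pl U(1)]
    \<comment> \<open>The vertices on the frontier recover the triple, so distinct empty triangles
      have distinct interiors.\<close>
    have "interior (convex hull U) \<noteq> ?f" using FU(2) F(2) U(2) by metis
    then have "interior (convex hull U) \<in> faces ?G'"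
      using keep FU(1) unfolding inner_faces_def by blast
    then have "interior (convex hull U) \<inter> point_set ?G' = {}"
      using in_components_subset unfolding faces_def by blast
    then show ?thesis using U(1) unfolding empty_triangle_def by blast
  qed
  show "v \<notin> V" by (rule S(3))
qed

section \<open>Private sets and the lower bound\<close>

text \<open>A private set is one that contains all the vertices of some face; since no edge meets two
  private sets, guarding the corresponding faces takes one edge for each.\<close>

definition private_sets :: "(real^2) set \<Rightarrow> (real^2) set set \<Rightarrow> (real^2) set set \<Rightarrow> bool" where
  "private_sets V E S \<longleftrightarrow> finite S \<and> \<Union>S \<subseteq> V \<and>
     (\<forall>A\<in>S. \<exists>f\<in>faces (straight_drawing V E). V \<inter> frontier f \<subseteq> A) \<and>
     (\<forall>e\<in>E. \<forall>A\<in>S. \<forall>B\<in>S. e \<inter> A \<noteq> {} \<and> e \<inter> B \<noteq> {} \<longrightarrow> A = B)"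

lemma private_sets_bound:
  assumes pl: "plane_graph (straight_drawing V E)" and S: "private_sets V E S"
    and \<Gamma>: "edge_guard_set (straight_drawing V E) \<Gamma>"
  shows "card S \<le> card \<Gamma>"
proof -
  have \<Gamma>E: "\<Gamma> \<subseteq> E" and fin: "finite \<Gamma>"
    using \<Gamma> finite_plane_graph_edges[OF pl] finite_subset by (auto simp: edge_guard_set_def)
  have "\<exists>e\<in>\<Gamma>. e \<inter> A \<noteq> {}" if A: "A \<in> S" for A
  proof -
    obtain f where f: "f \<in> faces (straight_drawing V E)" "V \<inter> frontier f \<subseteq> A"
      using S A unfolding private_sets_def by blast
    then obtain e w where "e \<in> \<Gamma>" "w \<in> e" "w \<in> frontier f"
      using \<Gamma> unfolding edge_guard_set_def guards_def by blast
    moreover from this have "w \<in> V" using \<Gamma>E finite_plane_graph_edges(2)[OF pl] by auto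
    ultimately show ?thesis using f(2) by blast
  qed
  then obtain h where h: "\<And>A. A \<in> S \<Longrightarrow> h A \<in> \<Gamma> \<and> h A \<inter> A \<noteq> {}" by metis
  then have "inj_on h S"
    using S \<Gamma>E unfolding private_sets_def inj_on_def by (metis subsetD)
  then show ?thesis using h fin by (intro card_inj_on_le[of h]) auto
qed

lemma private_sets_insert:
  assumes S: "private_sets V E S" and A: "A \<subseteq> V"
    and face: "\<exists>f\<in>faces (straight_drawing V E). V \<inter> frontier f \<subseteq> A"
    and sep: "\<And>e B. \<lbrakk>e \<in> E; e \<inter> A \<noteq> {}; B \<in> S\<rbrakk> \<Longrightarrow> e \<inter> B = {}"
  shows "private_sets V E (insert A S)"
  unfolding private_sets_def
proof (intro conjI)
  show "\<forall>e\<in>E. \<forall>B\<in>insert A S. \<forall>C\<in>insert A S. e \<inter> B \<noteq> {} \<and> e \<inter> C \<noteq> {} \<longrightarrow> B = C"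
    using S sep unfolding private_sets_def by (metis insert_iff)
qed (use S A face in \<open>simp_all add: private_sets_def\<close>)

text \<open>A face witnessing a private set is not the filled one, whose frontier vertices form the
  nonempty \<open>T\<close>, disjoint from all private sets; so it survives. The new edges have
  their ends in \<open>T\<close> and the new vertex, and thus meet no private set.\<close>

lemma private_sets_stack_step:
  assumes G: "stacked_triangulation (straight_drawing V E)" and T: "empty_triangle V E T"
    and v: "v \<in> interior (convex hull T)" and S: "private_sets V E S" "T \<inter> \<Union>S = {}"
  shows "private_sets (insert v V) (E \<union> (\<lambda>w. {v, w}) ` T) S"
proof -
  note step = stack_step[OF G T v]
  have FT: "V \<inter> frontier (interior (convex hull T)) = T"
    using empty_triangle_face(2)[OF stacked_triangulation_plane[OF G] T] .
  have "T \<noteq> {}" using T by (auto simp: empty_triangle_def)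
  have "\<exists>f\<in>faces (straight_drawing (insert v V) (E \<union> (\<lambda>w. {v, w}) ` T)).
      insert v V \<inter> frontier f \<subseteq> A" if A: "A \<in> S" for A
  proof -
    obtain f where f: "f \<in> faces (straight_drawing V E)" "V \<inter> frontier f \<subseteq> A"
      using S(1) A unfolding private_sets_def by blast
    moreover have "f \<noteq> interior (convex hull T)" using f(2) FT S(2) A \<open>T \<noteq> {}\<close> by blast
    ultimately show ?thesis using step(4) by blast
  qed
  moreover have "e \<inter> A = {}" if "e \<in> (\<lambda>w. {v, w}) ` T" "A \<in> S" for e A
    using that S step(1) unfolding private_sets_def by blast
  ultimately show ?thesis
    using S(1) unfolding private_sets_def by (simp add: ball_Un subset_insertI2)
qed

section \<open>The three-vertex gadget\<close>

text \<open>Stacking \<open>a\<close> into \<open>T\<close>, then \<open>b\<close> at \<open>a\<close>, then \<open>c\<close> at \<open>a\<close> and \<open>b\<close> creates the face \<open>abc\<close>,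
  all of whose incident edges stay within \<open>T \<union> {a, b, c}\<close>.\<close>

lemma private_sets_gadget:
  assumes G: "stacked_triangulation (straight_drawing V E)" and T: "empty_triangle V E T"
    and S: "private_sets V E S" "T \<inter> \<Union>S = {}"
  obtains V' E' A where "stacked_triangulation (straight_drawing V' E')"
    "V \<subseteq> V'" "card V' = card V + 3"
    "\<And>U. \<lbrakk>empty_triangle V E U; U \<noteq> T\<rbrakk> \<Longrightarrow> empty_triangle V' E' U"
    "private_sets V' E' (insert A S)" "A \<noteq> {}" "A \<inter> V = {}"
proof -
  have TV: "T \<subseteq> V" and c3: "card T = 3" using T by (auto simp: empty_triangle_def)
  then obtain p q r where pqr: "p \<noteq> q" "p \<noteq> r" "q \<noteq> r" "T = {p, q, r}"
    by (auto simp: card_3_iff)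
  have SV: "\<Union>S \<subseteq> V" using S unfolding private_sets_def by blast
  have pl: "plane_graph (straight_drawing V E)" using G by (rule stacked_triangulation_plane)
  have finV: "finite V" using pl by (simp add: plane_graph_def)
  have EV: "\<And>e. e \<in> E \<Longrightarrow> e \<subseteq> V" using finite_plane_graph_edges(2)[OF pl] by simp
  obtain a where ai: "a \<in> interior (convex hull T)"
    using empty_triangle_interior[OF T] .
  define Va Ea where "Va = insert a V" and "Ea = E \<union> (\<lambda>w. {a, w}) ` T"
  note a = stack_step[OF G T ai, folded Va_def Ea_def]
    empty_triangle_stack_new[OF T ai, folded Va_def Ea_def]
  note Sa = private_sets_stack_step[OF G T ai S, folded Va_def Ea_def]
  have Ta: "T - {r} = {p, q}" using pqr by auto
  have ta: "empty_triangle Va Ea {a, p, q}" using a(5)[of r] pqr(4) unfolding Ta by simp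
  have da: "{a, p, q} \<inter> \<Union>S = {}" using S(2) SV a(1) pqr(4) by blast
  obtain b where bi: "b \<in> interior (convex hull {a, p, q})"
    using empty_triangle_interior[OF ta] .
  define Vb Eb where "Vb = insert b Va" and "Eb = Ea \<union> (\<lambda>w. {b, w}) ` {a, p, q}"
  note b = stack_step[OF a(2) ta bi, folded Vb_def Eb_def]
    empty_triangle_stack_new[OF ta bi, folded Vb_def Eb_def]
  note Sb = private_sets_stack_step[OF a(2) ta bi Sa da, folded Vb_def Eb_def]
  have Tb: "{a, p, q} - {q} = {a, p}" using pqr a(1) TV by auto
  have tb: "empty_triangle Vb Eb {b, a, p}" using b(5)[of q] unfolding Tb by simp
  have db: "{b, a, p} \<inter> \<Union>S = {}" using S(2) SV a(1) b(1) pqr(4) unfolding Va_def by blast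
  obtain c where ci: "c \<in> interior (convex hull {b, a, p})"
    using empty_triangle_interior[OF tb] .
  define Vc Ec where "Vc = insert c Vb" and "Ec = Eb \<union> (\<lambda>w. {c, w}) ` {b, a, p}"
  note c = stack_step[OF b(2) tb ci, folded Vc_def Ec_def]
    empty_triangle_stack_new[OF tb ci, folded Vc_def Ec_def]
  note Sc = private_sets_stack_step[OF b(2) tb ci Sb db, folded Vc_def Ec_def]
  have Tc: "{b, a, p} - {p} = {b, a}" using pqr a(1) b(1) TV unfolding Va_def by auto
  have tc: "empty_triangle Vc Ec {c, b, a}" using c(5)[of p] unfolding Tc by simp
  let ?A = "{c, b, a}"
  have AV: "?A \<inter> V = {}" using a(1) b(1) c(1) unfolding Va_def Vb_def by auto
  have face: "\<exists>f\<in>faces (straight_drawing Vc Ec). Vc \<inter> frontier f \<subseteq> ?A"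
    using empty_triangle_face[OF stacked_triangulation_plane[OF c(2)] tc]
    unfolding inner_faces_def by blast
  have sep: "e \<inter> B = {}" if "e \<in> Ec" "e \<inter> ?A \<noteq> {}" "B \<in> S" for e B
  proof -
    \<comment> \<open>The vertices of \<open>?A\<close> are new, so \<open>e\<close> is an added
      edge; these join new vertices to each other or to \<open>T\<close>, which avoids the old
      private sets.\<close>
    have "e \<notin> E" using that EV AV by blast
    then have "e \<subseteq> ?A \<union> T" using that(1) pqr(4) unfolding Ec_def Eb_def Ea_def by auto
    moreover have "(?A \<union> T) \<inter> B = {}" using AV SV S(2) that(3) by blast
    ultimately show ?thesis by blast
  qed
  have "?A \<subseteq> Vc" unfolding Vc_def Vb_def Va_def by blast
  then have priv: "private_sets Vc Ec (insert ?A S)"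
    using Sc face sep by (intro private_sets_insert)
  have card: "card Vc = card V + 3"
    using finV a(1) b(1) c(1) unfolding Vc_def Vb_def Va_def by simp
  have "empty_triangle Vc Ec U" if U: "empty_triangle V E U" "U \<noteq> T" for U
  proof -
    \<comment> \<open>The triangles filled by \<open>b\<close> and \<open>c\<close> have the new
      corner \<open>a\<close>, so neither is an old triangle.\<close>
    have "U \<subseteq> V" using U(1) unfolding empty_triangle_def by blast
    then have "U \<noteq> {a, p, q}" "U \<noteq> {b, a, p}" using a(1) by auto
    then show ?thesis using U a(3) b(3) c(3) by blast
  qed
  moreover have "V \<subseteq> Vc" unfolding Vc_def Vb_def Va_def by blast
  ultimately show thesis using that[OF c(2) _ card _ priv _ AV] by blast
qed

section \<open>The starting configuration\<close>

text \<open>The open face \<open>xyz\<close> is the first face of the underlying triangulation; the outer triangle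
  \<open>abc\<close> plays the role of the gadget for its outer face.\<close>

lemma private_sets_start:
  obtains V E T A where "stacked_triangulation (straight_drawing V E)" "card V = 6"
    "empty_triangle V E T" "private_sets V E {A}" "T \<inter> A = {}"
proof -
  \<comment> \<open>An affine basis of the plane supplies the three outer corners.\<close>
  obtain T :: "(real^2) set" where aff: "\<not> affine_dependent T" and hull: "affine hull T = UNIV"
    using affine_basis_exists[of "UNIV :: (real^2) set"] by auto
  have c3: "card T = 3"
    using aff_dim_unique[of T UNIV] aff hull by (simp add: aff_dim_UNIV)
  then obtain a b c where abc: "a \<noteq> b" "b \<noteq> c" "a \<noteq> c" "T = {a, b, c}"
    by (auto simp: card_3_iff)
  have fin: "finite T" using aff aff_independent_finite by blast
  define E where "E = {{a, b}, {b, c}, {a, c}}"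
  let ?G = "straight_drawing T E"
  \<comment> \<open>Hulls of subsets of an independent set intersect in the hull of the common
    points, which for at most one point is that set itself.\<close>
  have hullInt: "convex hull e \<inter> convex hull e' = e \<inter> e'"
    if "e \<subseteq> T" "e' \<subseteq> T" "card (e \<inter> e') \<le> 1" for e e'
  proof -
    have "\<not> affine_dependent (e \<union> e')" using aff affine_dependent_subset that by blast
    then have "convex hull e \<inter> convex hull e' = convex hull (e \<inter> e')"
      using convex_hull_Int by blast
    moreover have "e \<inter> e' = {} \<or> (\<exists>w. e \<inter> e' = {w})"
      using that(1,3) fin by (metis card_0_eq card_1_singletonE finite_Int finite_subset le_antisym
          less_one linorder_not_less)
    ultimately show ?thesis by (metis convex_hull_empty convex_hull_singleton)
  qed
  have E2: "e \<subseteq> T \<and> card e = 2" if "e \<in> E" for e using that abc by (auto simp: E_def)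
  have pl: "plane_graph ?G"
    unfolding plane_graph_def straight_drawing_simps
  proof (intro conjI ballI impI)
    show "finite T" by (rule fin)
  next
    fix e assume "e \<in> E"
    then show "\<exists>u\<in>T. \<exists>v\<in>T. u \<noteq> v \<and> e = {u, v} \<and> arc_between u v (convex hull e)"
      using abc arc_between_segment unfolding E_def by blast
  next
    fix e assume e: "e \<in> E"
    have "w \<in> e" if w: "w \<in> convex hull e" "w \<in> T" for w
    proof (rule ccontr)
      assume "w \<notin> e"
      then have "e \<inter> {w} = {}" by simp
      then have "convex hull e \<inter> convex hull {w} = {}" using hullInt[of e "{w}"] E2[OF e] w(2) by simp
      then show False using w(1) by simp
    qed
    moreover have "e \<subseteq> convex hull e" by (rule hull_subset)
    ultimately show "convex hull e \<inter> T = e" using E2[OF e] by blast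
  next
    fix e e' assume e: "e \<in> E" "e' \<in> E" "e \<noteq> e'"
    then have "card (e \<inter> e') \<le> 1" using abc unfolding E_def by (auto simp: Int_insert_right)
    then show "convex hull e \<inter> convex hull e' = e \<inter> e'" using hullInt E2 e by blast
  qed
  have st: "stacked_triangulation ?G"
    by (rule stacked_triangulation.triangle[OF pl abc(1,2,3)]) (simp_all add: abc(4) E_def)
  have fr: "frontier (convex hull T) = (\<Union>e\<in>E. convex hull e)"
    unfolding abc(4) E_def triangle_frontier_sides[OF abc(1-3)] by blast
  have TE: "T \<subseteq> (\<Union>e\<in>E. convex hull e)" unfolding abc(4) E_def by (auto simp: hull_inc)
  have ps: "point_set ?G = frontier (convex hull T)" using fr TE by auto
  have tT: "empty_triangle T E T"
    unfolding empty_triangle_def ps using c3 aff abc(4)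
    by (auto simp: E_def frontier_def insert_commute)
  let ?o = "- (convex hull T)"
  have bdd: "bounded (convex hull T)" by (simp add: fin finite_imp_bounded bounded_convex_hull)
  have clo: "closed (convex hull T)" by (simp add: fin finite_imp_compact compact_convex_hull compact_imp_closed)
  have o: "?o \<in> faces ?G"
    unfolding faces_def ps
  proof (rule component_of_open_frontier)
    show "connected ?o" by (rule connected_complement_bounded_convex[OF bdd convex_convex_hull]) simp
    show "?o \<noteq> {}" using bdd not_bounded_UNIV by (metis Compl_UNIV_eq double_complement)
    show "?o \<inter> frontier (convex hull T) = {}" using clo by (auto simp: frontier_def)
  qed (simp add: frontier_complement)
  \<comment> \<open>The outer face is unbounded, so it is never the face being filled and persists
    through the three stackings below.\<close>
  have ub: "?o \<noteq> interior (convex hull U)" if "empty_triangle V' E' U" for U V' E'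
  proof
    assume "?o = interior (convex hull U)"
    moreover have "bounded (interior (convex hull U))"
      using that aff_independent_finite unfolding empty_triangle_def
      by (meson bounded_convex_hull bounded_interior finite_imp_bounded)
    ultimately have "bounded (convex hull T \<union> ?o)" using bdd by (simp del: Compl_partition)
    then show False by (simp add: not_bounded_UNIV)
  qed
  \<comment> \<open>Three nested stackings produce an empty triangle \<open>{z, y, x}\<close> that
    shares no corner with the outer triangle, as the iteration requires.\<close>
  obtain x where xi: "x \<in> interior (convex hull T)"
    using empty_triangle_interior[OF tT] .
  define Vx Ex where "Vx = insert x T" and "Ex = E \<union> (\<lambda>w. {x, w}) ` T"
  note x = stack_step[OF st tT xi, folded Vx_def Ex_def]
    empty_triangle_stack_new[OF tT xi, folded Vx_def Ex_def]
  have "T - {c} = {a, b}" using abc by auto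
  then have tx: "empty_triangle Vx Ex {x, a, b}" using x(5)[of c] abc(4) by simp
  obtain y where yi: "y \<in> interior (convex hull {x, a, b})"
    using empty_triangle_interior[OF tx] .
  define Vy Ey where "Vy = insert y Vx" and "Ey = Ex \<union> (\<lambda>w. {y, w}) ` {x, a, b}"
  note y = stack_step[OF x(2) tx yi, folded Vy_def Ey_def]
    empty_triangle_stack_new[OF tx yi, folded Vy_def Ey_def]
  have "{x, a, b} - {b} = {x, a}" using abc x(1) by auto
  then have ty: "empty_triangle Vy Ey {y, x, a}" using y(5)[of b] by simp
  obtain z where zi: "z \<in> interior (convex hull {y, x, a})"
    using empty_triangle_interior[OF ty] .
  define Vz Ez where "Vz = insert z Vy" and "Ez = Ey \<union> (\<lambda>w. {z, w}) ` {y, x, a}"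
  note z = stack_step[OF y(2) ty zi, folded Vz_def Ez_def]
    empty_triangle_stack_new[OF ty zi, folded Vz_def Ez_def]
  have "{y, x, a} - {a} = {y, x}" using abc x(1) y(1) unfolding Vx_def by auto
  then have tz: "empty_triangle Vz Ez {z, y, x}" using z(5)[of a] by simp
  have "?o \<in> faces (straight_drawing Vz Ez)" "x \<notin> frontier ?o" "y \<notin> frontier ?o" "z \<notin> frontier ?o"
    using x(4)[OF o ub[OF tT]] y(4)[OF _ ub[OF tx]] z(4)[OF _ ub[OF ty]] by blast+
  then have "private_sets Vz Ez {T}"
    unfolding private_sets_def Vz_def Vy_def Vx_def by blast
  moreover have "card Vz = 6"
    using c3 fin x(1) y(1) z(1) unfolding Vz_def Vy_def Vx_def by simp
  moreover have "{z, y, x} \<inter> T = {}"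
    using x(1) y(1) z(1) unfolding Vz_def Vy_def Vx_def by auto
  ultimately show thesis using that z(2) tz by blast
qed

section \<open>Iteration and counting\<close>

text \<open>A round stacks \<open>v\<close> into the open triangle, puts gadgets into two of the
  three parts and leaves \<open>{v, p, q}\<close> open: 1 + 3 + 3 = 7 vertices and two private sets
  more. The initial private set belongs to the outer face; the open triangle is not yet
  counted.\<close>

lemma private_sets_iterate:
  "\<exists>V E T S. stacked_triangulation (straight_drawing V E) \<and> card V = 6 + 7 * j \<and>
     empty_triangle V E T \<and> private_sets V E S \<and> T \<inter> \<Union>S = {} \<and> card S = 1 + 2 * j"
proof (induction j)
  case 0
  obtain V E T A where "stacked_triangulation (straight_drawing V E)" "card V = 6"
    "empty_triangle V E T" "private_sets V E {A}" "T \<inter> A = {}"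
    by (rule private_sets_start)
  then show ?case by (intro exI[of _ V] exI[of _ E] exI[of _ T] exI[of _ "{A}"]) simp
next
  case (Suc j)
  then obtain V E T S where G: "stacked_triangulation (straight_drawing V E)" and
    cV: "card V = 6 + 7 * j" and T: "empty_triangle V E T" and
    S: "private_sets V E S" "T \<inter> \<Union>S = {}" and cS: "card S = 1 + 2 * j" by blast
  have TV: "T \<subseteq> V" and c3: "card T = 3" using T by (auto simp: empty_triangle_def)
  then obtain p q r where pqr: "p \<noteq> q" "p \<noteq> r" "q \<noteq> r" "T = {p, q, r}"
    by (auto simp: card_3_iff)
  have SV: "\<Union>S \<subseteq> V" using S unfolding private_sets_def by blast
  have fin: "finite V" "finite S"
    using stacked_triangulation_plane[OF G] S unfolding plane_graph_def private_sets_def by auto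
  obtain v where vi: "v \<in> interior (convex hull T)"
    using empty_triangle_interior[OF T] .
  define W F where "W = insert v V" and "F = E \<union> (\<lambda>w. {v, w}) ` T"
  note v = stack_step[OF G T vi, folded W_def F_def]
    empty_triangle_stack_new[OF T vi, folded W_def F_def]
  note Sv = private_sets_stack_step[OF G T vi S, folded W_def F_def]
  have "T - {p} = {q, r}" "T - {q} = {p, r}" "T - {r} = {p, q}" using pqr by auto
  then have t: "empty_triangle W F {v, q, r}" "empty_triangle W F {v, p, r}" "empty_triangle W F {v, p, q}"
    using v(5)[of p] v(5)[of q] v(5)[of r] pqr(4) by simp_all
  \<comment> \<open>Distinctness lets each gadget preserve the triangles that it does not
    fill.\<close>
  have ne: "{v, q, r} \<noteq> {v, p, r}" "{v, q, r} \<noteq> {v, p, q}" "{v, p, r} \<noteq> {v, p, q}"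
    using pqr v(1) TV by auto
  have dis: "{v, p, q, r} \<inter> \<Union>S = {}" using v(1) SV S(2) pqr(4) by blast
  then have "{v, q, r} \<inter> \<Union>S = {}" by blast
  from private_sets_gadget[OF v(2) t(1) Sv this]
  obtain V1 E1 A where 1: "stacked_triangulation (straight_drawing V1 E1)"
    "W \<subseteq> V1" "card V1 = card W + 3"
    "\<And>U. \<lbrakk>empty_triangle W F U; U \<noteq> {v, q, r}\<rbrakk> \<Longrightarrow> empty_triangle V1 E1 U"
    "private_sets V1 E1 (insert A S)" "A \<noteq> {}" "A \<inter> W = {}" by blast
  have W: "v \<in> W" "p \<in> W" "q \<in> W" "r \<in> W" using TV pqr(4) unfolding W_def by auto
  have "{v, p, r} \<inter> \<Union>(insert A S) = {}" using dis W 1(7) by auto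
  from private_sets_gadget[OF 1(1) 1(4)[OF t(2) ne(1)[symmetric]] 1(5) this]
  obtain V2 E2 B where 2: "stacked_triangulation (straight_drawing V2 E2)"
    "V1 \<subseteq> V2" "card V2 = card V1 + 3"
    "\<And>U. \<lbrakk>empty_triangle V1 E1 U; U \<noteq> {v, p, r}\<rbrakk> \<Longrightarrow> empty_triangle V2 E2 U"
    "private_sets V2 E2 (insert B (insert A S))" "B \<noteq> {}" "B \<inter> V1 = {}" by blast
  have t2: "empty_triangle V2 E2 {v, p, q}"
    using 2(4)[OF 1(4)[OF t(3) ne(2)[symmetric]] ne(3)[symmetric]] .
  have d2: "{v, p, q} \<inter> \<Union>(insert B (insert A S)) = {}" using dis W 1(2,7) 2(7) by auto
  \<comment> \<open>\<open>A\<close> and \<open>B\<close> are nonempty and consist of vertices newer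
    than all earlier private sets, so the family really grows by two.\<close>
  have "A \<subseteq> V1" using 1(5) unfolding private_sets_def by blast
  moreover have "A \<notin> S" using 1(6,7) SV unfolding W_def by blast
  moreover have "\<Union>S \<subseteq> V1" using 1(2) SV unfolding W_def by blast
  ultimately have "A \<notin> S" "B \<notin> insert A S" using 2(6,7) by blast+
  then have "card (insert B (insert A S)) = 1 + 2 * Suc j" using cS fin by simp
  moreover have "card V2 = 6 + 7 * Suc j" using 1(3) 2(3) cV v(1) fin unfolding W_def by simp
  ultimately show ?case using 2(1,5) t2 d2 by blast
qed

theorem theorem4:
  fixes k :: nat
  assumes "even k" and "k > 0"
  shows "\<exists>G. stacked_triangulation G \<and>
           real (card (verts G)) = (7 * real k + 4) / 2 \<and>
           real k = (2 * real (card (verts G)) - 4) / 7 \<and>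
           (\<forall>\<Gamma>. edge_guard_set G \<Gamma> \<longrightarrow> k \<le> card \<Gamma>)"
proof -
  obtain j where k: "k = 2 + 2 * j"
    using assms by (metis dvdE mult.commute mult_Suc_right nat_0_less_mult_iff gr0_implies_Suc)
  obtain V E T S where G: "stacked_triangulation (straight_drawing V E)" "card V = 6 + 7 * j"
    "empty_triangle V E T" "private_sets V E S" "T \<inter> \<Union>S = {}" "card S = 1 + 2 * j"
    using private_sets_iterate by blast
  \<comment> \<open>A last gadget closes the open triangle: (1 + 2j) + 1 = k private sets and (6 +
    7j) + 3 = 9 + 7j = (7k + 4)/2 vertices.\<close>
  from private_sets_gadget[OF G(1,3,4,5)]
  obtain V' E' A where G': "stacked_triangulation (straight_drawing V' E')"
    "card V' = card V + 3" "private_sets V' E' (insert A S)" "A \<noteq> {}" "A \<inter> V = {}" by metis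
  have "A \<notin> S" "finite S" using G(4) G'(4,5) unfolding private_sets_def by blast+
  then have "card (insert A S) = k" using G(6) k by simp
  then have "\<forall>\<Gamma>. edge_guard_set (straight_drawing V' E') \<Gamma> \<longrightarrow> k \<le> card \<Gamma>"
    using private_sets_bound[OF stacked_triangulation_plane[OF G'(1)] G'(3)] by simp
  moreover have "card V' = 9 + 7 * j" using G'(2) G(2) by simp
  ultimately show ?thesis
    using G'(1) k by (intro exI[of _ "straight_drawing V' E'"]) simp
qed

end
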